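(* Let $(M,d)$ be a metric space, $T\subset\mathbb{R}$, $t_0\in T$, $X_0\in\mathrm{c}(M)$, and $F:T\to\mathrm{c}(M)$. (a) Let $a:=\inf T\in T$. If $\overrightarrow{V}(F,T)<+\infty$, then there exists a set-valued selector of bounded variation $\Gamma:T\to\mathrm{c}(M)$ of $F$ on $T$ such that $d_H(X_0,\Gamma(t_0))\le e(X_0,F(t_0))$, $V(\Gamma,T_{[a,t_0)})\le\overrightarrow{V}(F,T_{[a,t_0)})$, $V(\Gamma,T_{[t_0,+\infty)})\le\overrightarrow{V}(F,T_{[t_0,+\infty)})$, and $$V(\Gamma,T)-J_a(\Gamma,t_0)\le\overrightarrow{V}(F,T_{[a,t_0)})+\overrightarrow{V}(F,T_{[t_0,+\infty)})\le\overrightarrow{V}(F,T),$$ where $J_a(\Gamma,t_0):=0$ if $t_0=a$, and if $t_0>a$ and $s_0:=\sup T_{[a,t_0)}$, $$J_a(\Gamma,t_0):=\begin{cases} d_H(\Gamma(s_0),\Gamma(t_0)) & \text{if } s_0\in T_{[a,t_0)},\\ \displaystyle\lim_{T\ni t\to s_0-0}V(\Gamma,T_{[t,t_0]}) & \text{if } s_0\notin T_{[a,t_0)}.\end{cases}$$ In particular, if $t_0>a$ and $s_0=t_0$, then $J_a(\Gamma,t_0)=\displaystyle\lim_{T\ni t\to t_0-0}d_H(\Gamma(t),\Gamma(t_0))$. (b) Let $b:=\sup T\in T$. If $\overleftarrow{V}(F,T)<+\infty$, then there exists a set-valued selector of bounded variation $\Gamma:T\to\mathrm{c}(M)$ of $F$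 on $T$ such that $d_H(X_0,\Gamma(t_0))\le e(X_0,F(t_0))$, $V(\Gamma,T_{(t_0,b]})\le\overleftarrow{V}(F,T_{(t_0,b]})$, $V(\Gamma,T_{(-\infty,t_0]})\le\overleftarrow{V}(F,T_{(-\infty,t_0]})$, and $$V(\Gamma,T)-J_b(\Gamma,t_0)\le\overleftarrow{V}(F,T_{(t_0,b]})+\overleftarrow{V}(F,T_{(-\infty,t_0]})\le\overleftarrow{V}(F,T),$$ where $J_b(\Gamma,t_0):=0$ if $t_0=b$, and if $t_0<b$ and $s_0:=\inf T_{(t_0,b]}$, $$J_b(\Gamma,t_0):=\begin{cases} d_H(\Gamma(t_0),\Gamma(s_0)) & \text{if } s_0\in T_{(t_0,b]},\\ \displaystyle\lim_{T\ni t\to s_0+0}V(\Gamma,T_{[t_0,t]}) & \text{if } s_0\notin T_{(t_0,b]}.\end{cases}$$ In particular, if $t_0<b$ and $s_0=t_0$, then $J_b(\Gamma,t_0)=\displaystyle\lim_{T\ni t\to t_0+0}d_H(\Gamma(t_0),\Gamma(t))$. (The existence of the limits occurring above, as finite numbers, is part of the assertion.)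
   Context: $(M,d)$ is a metric space and $\mathrm{c}(M)$ is the family of all nonempty compact subsets of $M$. For nonempty $X,Y\subset M$, the Pompeiu excess of $X$ over $Y$ is $e(X,Y):=\sup_{x\in X}d(x,Y)$, where $d(x,Y):=\inf_{y\in Y}d(x,y)$ (in general $e(X,Y)\ne e(Y,X)$). The Pompeiu-Hausdorff metric on $\mathrm{c}(M)$ is $d_H(X,Y):=\max\{e(X,Y),e(Y,X)\}$. For $T\subset\mathbb{R}$ and $S\subset\mathbb{R}$, write $T_S:=T\cap S$ (e.g. $T_{[t_0,+\infty)}=T\cap[t_0,+\infty)$). For $F:T\to\mathrm{c}(M)$ and $A\subset T$ nonempty, define, with values in $[0,+\infty]$, $$V(F,A):=\sup_\pi\sum_{i=1}^m d_H(F(\tau_{i-1}),F(\tau_i)),\quad \overrightarrow{V}(F,A):=\sup_\pi\sum_{i=1}^m e(F(\tau_{i-1}),F(\tau_i)),\quad \overleftarrow{V}(F,A):=\sup_\pi\sum_{i=1}^m e(F(\tau_i),F(\tau_{i-1})),$$ the suprema being over all partitions $\pi$ of $A$, i.e. all $m\in\mathbb{N}$ and points $\tau_0\le\tau_1\le\dots\le\tau_m$ in $A$; all three are $0$ for $A=\varnothing$. $V$ is the Jordan variation, and $\overrightarrow{V}$, $\overleftarrow{V}$ are the directional variations to the right and to the left. $F$ is of bounded variation if $V(F,T)<+\infty$. $\Gamma:T\to\mathrm{c}(M)$ is a set-valued selector of $F$ on $T$ if $\Gamma(t)\subset F(t)$ for all $t\in T$. The notation $\lim_{T\ni t\to s-0}$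 (resp. $\lim_{T\ni t\to s+0}$) means the limit as $t\to s$ along $t\in T$ with $t<s$ (resp. $t>s$). *)

theory Defs
  imports "HOL-Analysis.Analysis"
begin

definition nonempty_compacts :: "'a::metric_space set set" where
  "nonempty_compacts = {K. compact K \<and> K \<noteq> {}}"

(* The supremum is taken in the reals, so this is the Pompeiu excess only when it is finite,
   in particular for nonempty compact X and Y. *)
definition excess :: "'a::metric_space set \<Rightarrow> 'a set \<Rightarrow> real" where
  "excess X Y = (SUP x\<in>X. infdist x Y)"

definition hausdorff_distance :: "'a::metric_space set \<Rightarrow> 'a set \<Rightarrow> real" where
  "hausdorff_distance X Y = max (excess X Y) (excess Y X)"

definition partitions :: "real set \<Rightarrow> (nat \<times> (nat \<Rightarrow> real)) set" where
  "partitions A = {(m, \<tau>). (\<forall>i\<le>m. \<tau> i \<in> A) \<and> (\<forall>i\<in>{1..m}. \<tau> (i - 1) \<le> \<tau> i)}"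

(* The case distinction is needed because the supremum of the empty set is -\<infinity> in ereal. *)
definition variation_wrt :: "('b \<Rightarrow> 'b \<Rightarrow> real) \<Rightarrow> (real \<Rightarrow> 'b) \<Rightarrow> real set \<Rightarrow> ereal" where
  "variation_wrt c F A =
    (if A = {} then 0
     else SUP (m, \<tau>)\<in>partitions A. ereal (\<Sum>i=1..m. c (F (\<tau> (i - 1))) (F (\<tau> i))))"

definition jordan_variation :: "(real \<Rightarrow> 'a::metric_space set) \<Rightarrow> real set \<Rightarrow> ereal" where
  "jordan_variation = variation_wrt hausdorff_distance"

definition right_variation :: "(real \<Rightarrow> 'a::metric_space set) \<Rightarrow> real set \<Rightarrow> ereal" where
  "right_variation = variation_wrt excess"

definition left_variation :: "(real \<Rightarrow> 'a::metric_space set) \<Rightarrow> real set \<Rightarrow> ereal" where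
  "left_variation = variation_wrt (\<lambda>X Y. excess Y X)"

definition bounded_variation_on :: "real set \<Rightarrow> (real \<Rightarrow> 'a::metric_space set) \<Rightarrow> bool" where
  "bounded_variation_on T F \<longleftrightarrow> jordan_variation F T < \<infinity>"

definition set_valued_selector ::
    "real set \<Rightarrow> (real \<Rightarrow> 'a::metric_space set) \<Rightarrow> (real \<Rightarrow> 'a set) \<Rightarrow> bool" where
  "set_valued_selector T F \<Gamma> \<longleftrightarrow> \<Gamma> \<in> T \<rightarrow> nonempty_compacts \<and> (\<forall>t\<in>T. \<Gamma> t \<subseteq> F t)"

(* Lim is a definite description: J_left and J_right are meaningful in their last case only
   if the limit exists, which has to be asserted separately. *)
definition J_left ::
    "real set \<Rightarrow> real \<Rightarrow> (real \<Rightarrow> 'a::metric_space set) \<Rightarrow> real \<Rightarrow> ereal" where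
  "J_left T a \<Gamma> t0 =
    (if t0 = a then 0
     else let s0 = Sup (T \<inter> {a..<t0}) in
       if s0 \<in> T \<inter> {a..<t0} then ereal (hausdorff_distance (\<Gamma> s0) (\<Gamma> t0))
       else Lim (at s0 within (T \<inter> {..<s0})) (\<lambda>t. jordan_variation \<Gamma> (T \<inter> {t..t0})))"

definition J_right ::
    "real set \<Rightarrow> real \<Rightarrow> (real \<Rightarrow> 'a::metric_space set) \<Rightarrow> real \<Rightarrow> ereal" where
  "J_right T b \<Gamma> t0 =
    (if t0 = b then 0
     else let s0 = Inf (T \<inter> {t0<..b}) in
       if s0 \<in> T \<inter> {t0<..b} then ereal (hausdorff_distance (\<Gamma> t0) (\<Gamma> s0))
       else Lim (at s0 within (T \<inter> {s0<..})) (\<lambda>t. jordan_variation \<Gamma> (T \<inter> {t0..t})))"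

end

theory Submission
  imports Defs
begin

text \<open>
Suppose first that \<^term>\<open>t0\<close> is the least point of \<^term>\<open>T\<close>. Finite variation to the right means
that the excess from \<open>F s\<close> to \<open>F t\<close>, for \<open>s \<le> t\<close>, is at most \<open>v t - v s\<close>, where \<open>v\<close> is a bounded
real function (the variation of \<open>F\<close> up to a given time): lemma \<open>variation_potential\<close>. Conversely,
any cost that is dominated by the increments of \<open>v\<close> has variation at most the oscillation of \<open>v\<close>,
by telescoping: lemma \<open>variation_le_potential\<close>. A bound on the variation has thus become a condition
on pairs of times.

Consider all point selections \<open>\<gamma>\<close> of \<open>F\<close> with \<open>dist (\<gamma> s) (\<gamma> t) \<le> v t - v s\<close> for \<open>s \<le> t\<close> that start in
a compact set \<open>Y \<subseteq> F t0\<close>, and let \<open>\<Gamma> t\<close> be the set of their values at \<open>t\<close>. Every point of \<open>\<Gamma> s\<close>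
lies on some \<open>\<gamma>\<close>, whose value at \<open>t\<close> is a nearby point of \<open>\<Gamma> t\<close>, and vice versa. So the symmetric
distance between \<open>\<Gamma> s\<close> and \<open>\<Gamma> t\<close> is at most \<open>v t - v s\<close>, although only a one-sided excess of
\<open>F\<close> is controlled. Each \<open>\<Gamma> t\<close> is compact, being a coordinate projection of a closed subset of a
product of compact sets (Tychonoff). It remains to see that a selection starts at each point of
\<open>Y\<close>. By compactness it suffices to treat finitely many times, and there one proceeds greedily from
left to right, choosing a nearest point of the next set. This is where a first time is needed. With
\<open>Y = {y \<in> F t0. infdist y X0 \<le> excess X0 (F t0)}\<close> one gets the estimate at \<^term>\<open>t0\<close>. All this is
lemma \<open>set_valued_selection\<close>.

In general, this construction is applied separately to the part of \<^term>\<open>T\<close> before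
\<^term>\<open>t0\<close>, whose first time, if there is any, is the least point of
\<^term>\<open>T\<close>, and to the part from \<^term>\<open>t0\<close> on.
The two selectors are unrelated at \<^term>\<open>t0\<close>; the jump created there is finite, and it accounts for
the term \<^const>\<open>J_left\<close>. Everything about the jump holds for an arbitrary compact-valued function of
bounded variation (\<open>jump_limit\<close>, \<open>jordan_variation_minus_jump\<close>, \<open>jump_at_limit_point\<close>).

The statement on the variation to the left follows by reversing time.
\<close>

section \<open>Pompeiu excess and Pompeiu-Hausdorff distance on compact sets\<close>

lemma nearest_point:
  fixes x :: "'a::metric_space"
  assumes "Y \<in> nonempty_compacts"
  obtains y where "y \<in> Y" "infdist x Y = dist x y"
proof -
  have Y: "compact Y" "Y \<noteq> {}"
    using assms by (auto simp: nonempty_compacts_def)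
  obtain y where y: "y \<in> Y" "\<And>z. z \<in> Y \<Longrightarrow> dist x y \<le> dist x z"
    using continuous_attains_inf[OF Y, of "dist x"] continuous_on_dist[OF continuous_on_const continuous_on_id]
    by blast
  have "infdist x Y = dist x y"
    unfolding infdist_notempty[OF Y(2)]
    by (rule antisym) (use y Y in \<open>auto intro!: cINF_lower2 cINF_greatest bdd_belowI2[where m=0]\<close>)
  then show ?thesis using y that by blast
qed

lemma infdist_le_excess:
  assumes "X \<in> nonempty_compacts" "x \<in> X"
  shows "infdist x Y \<le> excess X Y"
proof -
  have "compact ((\<lambda>x. infdist x Y) ` X)"
    using assms by (auto simp: nonempty_compacts_def intro!: compact_continuous_image continuous_intros)
  then have "bdd_above ((\<lambda>x. infdist x Y) ` X)"
    by (intro bounded_imp_bdd_above compact_imp_bounded)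
  then show ?thesis
    unfolding excess_def using assms by (auto intro: cSUP_upper)
qed

lemma excess_le:
  assumes "X \<in> nonempty_compacts" "\<And>x. x \<in> X \<Longrightarrow> infdist x Y \<le> r"
  shows "excess X Y \<le> r"
  unfolding excess_def using assms by (auto simp: nonempty_compacts_def intro: cSUP_least)

lemma excess_nonneg:
  assumes "X \<in> nonempty_compacts"
  shows "0 \<le> excess X Y"
proof -
  obtain x where "x \<in> X" using assms by (auto simp: nonempty_compacts_def)
  then show ?thesis
    using infdist_le_excess[OF assms, of x Y] infdist_nonneg[of x Y] by linarith
qed

lemma excess_self:
  assumes "X \<in> nonempty_compacts"
  shows "excess X X = 0"
  using excess_le[OF assms, of X 0] excess_nonneg[OF assms, of X] by fastforce

lemma excess_triangle:
  assumes "X \<in> nonempty_compacts" "Y \<in> nonempty_compacts"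
  shows "excess X Z \<le> excess X Y + excess Y Z"
proof (rule excess_le[OF assms(1)])
  fix x assume x: "x \<in> X"
  obtain y where y: "y \<in> Y" "infdist x Y = dist x y"
    using nearest_point[OF assms(2)] .
  have "infdist x Z \<le> infdist y Z + dist x y" by (rule infdist_triangle)
  also have "\<dots> \<le> excess Y Z + excess X Y"
    using infdist_le_excess[OF assms(2) y(1), of Z] infdist_le_excess[OF assms(1) x, of Y] y by linarith
  finally show "infdist x Z \<le> excess X Y + excess Y Z" by simp
qed

lemma hausdorff_distance_commute: "hausdorff_distance X Y = hausdorff_distance Y X"
  by (simp add: hausdorff_distance_def max.commute)

lemma hausdorff_distance_nonneg:
  "X \<in> nonempty_compacts \<Longrightarrow> 0 \<le> hausdorff_distance X Y"
  by (simp add: hausdorff_distance_def excess_nonneg le_max_iff_disj)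

lemma hausdorff_distance_self:
  "X \<in> nonempty_compacts \<Longrightarrow> hausdorff_distance X X = 0"
  by (simp add: hausdorff_distance_def excess_self)

lemma hausdorff_distance_triangle:
  assumes "X \<in> nonempty_compacts" "Y \<in> nonempty_compacts" "Z \<in> nonempty_compacts"
  shows "hausdorff_distance X Z \<le> hausdorff_distance X Y + hausdorff_distance Y Z"
  using excess_triangle[OF assms(1,2), of Z] excess_triangle[OF assms(3,2), of X]
  by (auto simp: hausdorff_distance_def)

lemma hausdorff_distance_le:
  assumes "X \<in> nonempty_compacts" "Y \<in> nonempty_compacts"
    and "\<And>x. x \<in> X \<Longrightarrow> \<exists>y\<in>Y. dist x y \<le> r" "\<And>y. y \<in> Y \<Longrightarrow> \<exists>x\<in>X. dist x y \<le> r"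
  shows "hausdorff_distance X Y \<le> r"
proof -
  have "excess X Y \<le> r"
    using assms(3) by (intro excess_le[OF assms(1)]) (meson infdist_le order_trans)
  moreover have "excess Y X \<le> r"
    using assms(4) by (intro excess_le[OF assms(2)]) (metis dist_commute infdist_le order_trans)
  ultimately show ?thesis by (simp add: hausdorff_distance_def)
qed

section \<open>Variation with respect to a cost\<close>

lemma partition_sum_le_variation:
  assumes "(m, \<tau>) \<in> partitions A"
  shows "ereal (\<Sum>i=1..m. c (G (\<tau> (i - 1))) (G (\<tau> i))) \<le> variation_wrt c G A"
proof -
  have "\<tau> 0 \<in> A" using assms by (auto simp: partitions_def)
  then show ?thesis
    unfolding variation_wrt_def using assms by (auto intro!: SUP_upper2[OF assms])
qed

lemma variation_le:
  assumes "\<And>m \<tau>. (m, \<tau>) \<in> partitions A \<Longrightarrow> ereal (\<Sum>i=1..m. c (G (\<tau> (i - 1))) (G (\<tau> i))) \<le> b"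
    and "0 \<le> b"
  shows "variation_wrt c G A \<le> b"
  unfolding variation_wrt_def using assms by (auto intro!: SUP_least)

lemma variation_nonneg: "0 \<le> variation_wrt c G A"
proof (cases "A = {}")
  case False
  then obtain x where "x \<in> A" by blast
  then have "(0, \<lambda>_. x) \<in> partitions A" by (auto simp: partitions_def)
  from partition_sum_le_variation[OF this, of c G] show ?thesis by (simp flip: zero_ereal_def)
qed (simp add: variation_wrt_def)

lemma variation_empty: "variation_wrt c G {} = 0"
  by (simp add: variation_wrt_def)

lemma variation_mono:
  assumes "A \<subseteq> B"
  shows "variation_wrt c G A \<le> variation_wrt c G B"
proof (rule variation_le[OF _ variation_nonneg])
  fix m \<tau> assume "(m, \<tau>) \<in> partitions A"
  then have "(m, \<tau>) \<in> partitions B" using assms by (auto simp: partitions_def)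
  then show "ereal (\<Sum>i=1..m. c (G (\<tau> (i - 1))) (G (\<tau> i))) \<le> variation_wrt c G B"
    by (rule partition_sum_le_variation)
qed

lemma variation_cong:
  assumes "\<And>t. t \<in> A \<Longrightarrow> G t = H t"
  shows "variation_wrt c G A = variation_wrt c H A"
proof -
  have le: "variation_wrt c G A \<le> variation_wrt c H A"
    if "\<And>t. t \<in> A \<Longrightarrow> G t = H t" for G H
  proof (rule variation_le[OF _ variation_nonneg])
    fix m \<tau> assume p: "(m, \<tau>) \<in> partitions A"
    then have "G (\<tau> i) = H (\<tau> i)" if "i \<le> m" for i
      using \<open>\<And>t. t \<in> A \<Longrightarrow> G t = H t\<close> that by (auto simp: partitions_def)
    then have "(\<Sum>i=1..m. c (G (\<tau> (i - 1))) (G (\<tau> i))) = (\<Sum>i=1..m. c (H (\<tau> (i - 1))) (H (\<tau> i)))"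
      by (intro sum.cong) auto
    with partition_sum_le_variation[OF p, of c H]
    show "ereal (\<Sum>i=1..m. c (G (\<tau> (i - 1))) (G (\<tau> i))) \<le> variation_wrt c H A" by simp
  qed
  show ?thesis using assms by (intro antisym le) auto
qed

lemma cost_le_variation:
  assumes "s \<in> A" "t \<in> A" "s \<le> t"
  shows "ereal (c (G s) (G t)) \<le> variation_wrt c G A"
proof -
  have "(1, \<lambda>i. if i = 0 then s else t) \<in> partitions A"
    using assms by (auto simp: partitions_def)
  from partition_sum_le_variation[OF this, of c G] show ?thesis by simp
qed

text \<open>
A partition of an earlier set followed by a partition of a later one is a partition of the union;
the step that joins them contributes a nonnegative cost.
\<close>

lemma variation_superadditive:
  assumes nonneg: "\<And>s t. s \<in> A \<Longrightarrow> t \<in> B \<Longrightarrow> 0 \<le> c (G s) (G t)"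
    and order: "\<And>s t. s \<in> A \<Longrightarrow> t \<in> B \<Longrightarrow> s \<le> t"
  shows "variation_wrt c G A + variation_wrt c G B \<le> variation_wrt c G (A \<union> B)"
proof -
  let ?W = "variation_wrt c G (A \<union> B)"
  let ?sum = "\<lambda>m \<tau>. \<Sum>i=1..m. c (G (\<tau> (i - 1))) (G (\<tau> i))"
  have concat: "ereal (?sum m \<tau>) + ereal (?sum n \<sigma>) \<le> ?W"
    if p: "(m, \<tau>) \<in> partitions A" "(n, \<sigma>) \<in> partitions B" for m \<tau> n \<sigma>
  proof -
    \<comment> \<open>The concatenation has the points of index at most m from the first partition and continues
      with index m + 1 from the second, so that it has one more step than both together.\<close>
    define \<rho> where "\<rho> i = (if i \<le> m then \<tau> i else \<sigma> (i - Suc m))" for i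
    have \<tau>: "\<tau> i \<in> A" if "i \<le> m" for i using p that by (auto simp: partitions_def)
    have \<sigma>: "\<sigma> i \<in> B" if "i \<le> n" for i using p that by (auto simp: partitions_def)
    have "\<rho> (i - 1) \<le> \<rho> i" if i: "1 \<le> i" "i \<le> m + 1 + n" for i
    proof -
      consider "i \<le> m" | "i = Suc m" | "i > Suc m" by linarith
      then show ?thesis
      proof cases
        case 1
        then show ?thesis using p i by (auto simp: \<rho>_def partitions_def)
      next
        case 2
        then show ?thesis using order[OF \<tau>[of m] \<sigma>[of 0]] by (auto simp: \<rho>_def)
      next
        case 3
        then have "i - Suc m \<in> {1..n}" using i by auto
        then have "\<sigma> (i - Suc m - 1) \<le> \<sigma> (i - Suc m)"
            using p unfolding partitions_def by blast
        moreover have "i - 1 - Suc m = i - Suc m - 1" by simp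
        ultimately show ?thesis using 3 by (auto simp: \<rho>_def)
      qed
    qed
    moreover have "\<rho> i \<in> A \<union> B" if "i \<le> m + 1 + n" for i
      using \<tau>[of i] \<sigma>[of "i - Suc m"] that by (auto simp: \<rho>_def)
    ultimately have "(m + 1 + n, \<rho>) \<in> partitions (A \<union> B)"
      by (auto simp: partitions_def)
    then have le: "ereal (?sum (m + 1 + n) \<rho>) \<le> ?W"
      by (rule partition_sum_le_variation)
    \<comment> \<open>Splitting off the joining step is an induction on the length of the second part.\<close>
    have "?sum (m + 1 + k) \<rho> = ?sum m \<tau> + c (G (\<tau> m)) (G (\<sigma> 0)) + ?sum k \<sigma>" for k
    proof (induction k)
      case 0
      have "?sum m \<rho> = ?sum m \<tau>" by (rule sum.cong) (auto simp: \<rho>_def)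
      then show ?case by (simp add: \<rho>_def)
    next
      case (Suc k)
      then show ?case by (simp add: \<rho>_def)
    qed
    then have "?sum m \<tau> + ?sum n \<sigma> \<le> ?sum (m + 1 + n) \<rho>"
      using nonneg[OF \<tau>[of m] \<sigma>[of 0]] by simp
    then show ?thesis using le by (simp add: order_trans[OF _ le])
  qed
  show ?thesis
  proof (cases "A = {} \<or> B = {} \<or> ?W = \<infinity>")
    case True
    then show ?thesis by (auto simp: variation_empty)
  next
    case False
    then obtain w where w: "?W = ereal w"
      using variation_nonneg[of c G "A \<union> B"] by (cases ?W) auto
    have "variation_wrt c G A \<le> ?W" "variation_wrt c G B \<le> ?W" by (auto intro: variation_mono)
    then obtain u v where u: "variation_wrt c G A = ereal u" and v: "variation_wrt c G B = ereal v"
      using w variation_nonneg[of c G A] variation_nonneg[of c G B]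
      by (cases "variation_wrt c G A"; cases "variation_wrt c G B") auto
    have *: "u \<le> w - ?sum n \<sigma>" if "(n, \<sigma>) \<in> partitions B" for n \<sigma>
    proof -
      have "variation_wrt c G A \<le> ereal (w - ?sum n \<sigma>)"
      proof (rule variation_le)
        show "0 \<le> ereal (w - ?sum n \<sigma>)"
          using partition_sum_le_variation[OF that, of c G] v w \<open>variation_wrt c G B \<le> ?W\<close> by simp
        show "ereal (?sum m \<tau>) \<le> ereal (w - ?sum n \<sigma>)" if "(m, \<tau>) \<in> partitions A" for m \<tau>
          using concat[OF that \<open>(n, \<sigma>) \<in> partitions B\<close>] w by simp
      qed
      then show ?thesis using u by simp
    qed
    have "variation_wrt c G B \<le> ereal (w - u)"
      by (rule variation_le) (use * \<open>variation_wrt c G A \<le> ?W\<close> u w in \<open>auto simp: algebra_simps\<close>)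
    then show ?thesis using u v w by simp
  qed
qed

text \<open>
If the cost of a step is at most the increment of a real function \<open>v\<close>, the sum over a partition
telescopes. This turns bounds on variations into inequalities between pairs of times, and nearly
every upper bound below comes from a suitable \<open>v\<close>.
\<close>

lemma variation_le_potential:
  assumes potential: "\<And>s t. s \<in> A \<Longrightarrow> t \<in> A \<Longrightarrow> s \<le> t \<Longrightarrow> c (G s) (G t) \<le> v t - v s"
    and range: "\<And>t. t \<in> A \<Longrightarrow> p \<le> v t \<and> v t \<le> q" and "p \<le> q"
  shows "variation_wrt c G A \<le> ereal (q - p)"
proof (rule variation_le)
  fix m \<tau> assume p: "(m, \<tau>) \<in> partitions A"
  have \<tau>: "\<tau> i \<in> A" if "i \<le> m" for i using p that by (auto simp: partitions_def)
  have mono: "\<tau> (i - 1) \<le> \<tau> i" if "i \<in> {1..m}" for i using p that by (auto simp: partitions_def)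
  have "(\<Sum>i=1..m. c (G (\<tau> (i - 1))) (G (\<tau> i))) \<le> (\<Sum>i=1..m. v (\<tau> i) - v (\<tau> (i - 1)))"
    by (intro sum_mono potential \<tau> mono) auto
  also have "\<dots> = v (\<tau> m) - v (\<tau> 0)"
    by (induction m) auto
  also have "\<dots> \<le> q - p" using range[OF \<tau>[of m]] range[OF \<tau>[of 0]] by simp
  finally show "ereal (\<Sum>i=1..m. c (G (\<tau> (i - 1))) (G (\<tau> i))) \<le> ereal (q - p)" by simp
qed (use assms in auto)

text \<open>
The converse: the variation up to time \<open>t\<close> is a potential of the kind used in the previous lemma,
because appending the step from \<open>s\<close> to \<open>t\<close> to the part up to \<open>s\<close> is an instance of superadditivity.
\<close>

lemma variation_potential:
  assumes nonneg: "\<And>s t. s \<in> A \<Longrightarrow> t \<in> A \<Longrightarrow> 0 \<le> c (G s) (G t)"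
    and fin: "variation_wrt c G A = ereal q"
  obtains v where "\<And>s t. s \<in> A \<Longrightarrow> t \<in> A \<Longrightarrow> s \<le> t \<Longrightarrow> c (G s) (G t) \<le> v t - v s"
    "\<And>t. 0 \<le> v t \<and> v t \<le> q"
proof -
  define v where "v t = real_of_ereal (variation_wrt c G (A \<inter> {..t}))" for t
  have v: "variation_wrt c G (A \<inter> {..t}) = ereal (v t)" "0 \<le> v t \<and> v t \<le> q" for t
  proof -
    have "variation_wrt c G (A \<inter> {..t}) \<le> ereal q" "0 \<le> variation_wrt c G (A \<inter> {..t})"
      using variation_mono[of "A \<inter> {..t}" A c G] fin by (auto intro: variation_nonneg)
    then show "variation_wrt c G (A \<inter> {..t}) = ereal (v t)" "0 \<le> v t \<and> v t \<le> q"
      unfolding v_def by (cases "variation_wrt c G (A \<inter> {..t})"; simp)+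
  qed
  show ?thesis
  proof (rule that[of v])
    fix s t assume st: "s \<in> A" "t \<in> A" "s \<le> t"
    have "ereal (v s) + ereal (c (G s) (G t))
        \<le> variation_wrt c G (A \<inter> {..s}) + variation_wrt c G (A \<inter> {s..t})"
      using st by (intro add_mono cost_le_variation) (auto simp: v)
    also have "\<dots> \<le> variation_wrt c G (A \<inter> {..s} \<union> A \<inter> {s..t})"
      by (rule variation_superadditive) (auto intro: nonneg)
    also have "\<dots> \<le> variation_wrt c G (A \<inter> {..t})"
      using st by (intro variation_mono) auto
    finally show "c (G s) (G t) \<le> v t - v s" by (simp add: v)
  qed (use v in auto)
qed

section \<open>Selections controlled by a potential\<close>

text \<open>
Move from left to right and choose at each new time a nearest point of the next set. Only
consecutive times are compared directly; for the other pairs the triangle inequality suffices, since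
the increments of \<open>v\<close> add up. That \<open>t1\<close> comes first is essential, as the excess gives no control in
the other direction.
\<close>

lemma finite_chain_selection:
  fixes F :: "real \<Rightarrow> 'a::metric_space set"
  assumes F: "F \<in> A \<rightarrow> nonempty_compacts"
    and least: "t1 \<in> A" "\<And>t. t \<in> A \<Longrightarrow> t1 \<le> t"
    and potential: "\<And>s t. s \<in> A \<Longrightarrow> t \<in> A \<Longrightarrow> s \<le> t \<Longrightarrow> excess (F s) (F t) \<le> v t - v s"
    and y: "y \<in> F t1"
    and E: "finite E" "E \<subseteq> A"
  shows "\<exists>\<gamma>. \<gamma> t1 = y \<and> (\<forall>t\<in>A. \<gamma> t \<in> F t) \<and>
    (\<forall>s\<in>insert t1 E. \<forall>t\<in>insert t1 E. s \<le> t \<longrightarrow> dist (\<gamma> s) (\<gamma> t) \<le> v t - v s)"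
  using E
proof (induction E rule: finite_linorder_max_induct)
  case empty
  define \<gamma> where "\<gamma> t = (if t = t1 then y else SOME z. z \<in> F t)" for t
  have "(SOME z. z \<in> F t) \<in> F t" if "t \<in> A" for t
    using F that by (auto simp: nonempty_compacts_def Pi_iff some_in_eq)
  then show ?case using y by (intro exI[of _ \<gamma>]) (auto simp: \<gamma>_def)
next
  case (insert b E)
  then obtain \<gamma> where \<gamma>: "\<gamma> t1 = y" "\<forall>t\<in>A. \<gamma> t \<in> F t"
    "\<forall>s\<in>insert t1 E. \<forall>t\<in>insert t1 E. s \<le> t \<longrightarrow> dist (\<gamma> s) (\<gamma> t) \<le> v t - v s"
    by auto
  have b: "b \<in> A" "t1 \<le> b" using insert least by auto
  show ?case
  proof (cases "b = t1")
    case True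
    then show ?thesis using \<gamma> by (intro exI[of _ \<gamma>]) auto
  next
    case False
    define m where "m = Max (insert t1 E)"
    have m: "m \<in> insert t1 E" "\<And>s. s \<in> insert t1 E \<Longrightarrow> s \<le> m"
      unfolding m_def using insert(1) Max_in[of "insert t1 E"] Max_ge[of "insert t1 E"] by auto
    have "m \<in> A" using m(1) insert.prems least(1) by auto
    moreover have "m < b" using m(1) insert.hyps b False by auto
    ultimately have mA: "m \<in> A" "m < b" by auto
    obtain z where z: "z \<in> F b" "infdist (\<gamma> m) (F b) = dist (\<gamma> m) z"
      using nearest_point[of "F b"] F b by auto
    have "dist (\<gamma> m) z \<le> excess (F m) (F b)"
      using infdist_le_excess[of "F m" "\<gamma> m" "F b"] F \<gamma>(2) mA z by (simp add: Pi_iff)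
    also have "\<dots> \<le> v b - v m" using potential mA b by simp
    finally have step: "dist (\<gamma> m) z \<le> v b - v m" .
    have "dist (\<gamma> s) z \<le> v b - v s" if "s \<in> insert t1 E" for s
      using \<gamma>(3) that m step dist_triangle[of "\<gamma> s" z "\<gamma> m"] by fastforce
    moreover have "s < b" if "s \<in> insert t1 E" for s using m(2)[OF that] mA by simp
    moreover have "b \<notin> insert t1 E" "\<not> b \<le> s" if "s \<in> insert t1 E" for s
      using that insert.hyps b False by auto
    ultimately have "\<forall>s\<in>insert t1 (insert b E). \<forall>t\<in>insert t1 (insert b E). s \<le> t \<longrightarrow>
        dist ((\<gamma>(b := z)) s) ((\<gamma>(b := z)) t) \<le> v t - v s"
      using \<gamma>(3) by auto
    then show ?thesis
      using \<gamma>(1,2) z(1) False by (intro exI[of _ "\<gamma>(b := z)"]) auto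
  qed
qed

lemma compact_product:
  fixes K :: "'i \<Rightarrow> 'b::topological_space set"
  assumes "\<And>i. compact (K i)"
  shows "compact {f. \<forall>i. f i \<in> K i}"
proof -
  have "compactin (product_topology (\<lambda>_. euclidean) UNIV) (PiE UNIV K)"
    using assms by (auto simp: compactin_PiE)
  moreover have "PiE UNIV K = {f. \<forall>i. f i \<in> K i}" by auto
  ultimately show ?thesis by (simp add: euclidean_product_topology)
qed

lemma closed_dist_le:
  "closed {\<gamma> :: 'i \<Rightarrow> 'a::metric_space. dist (\<gamma> s) (\<gamma> t) \<le> r}"
  by (intro closed_Collect_le continuous_intros continuous_on_product_coordinates)

text \<open>
Each condition on a pair of times is closed in the product topology and involves two coordinates
only, so the finite case and the compactness of the product give all conditions at once. The value
outside \<open>A\<close> is fixed to make every factor of the product compact.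
\<close>

lemma point_selection:
  fixes F :: "real \<Rightarrow> 'a::metric_space set"
  assumes F: "F \<in> A \<rightarrow> nonempty_compacts"
    and least: "t1 \<in> A" "\<And>t. t \<in> A \<Longrightarrow> t1 \<le> t"
    and potential: "\<And>s t. s \<in> A \<Longrightarrow> t \<in> A \<Longrightarrow> s \<le> t \<Longrightarrow> excess (F s) (F t) \<le> v t - v s"
    and y: "y \<in> F t1"
  shows "\<exists>\<gamma>. \<gamma> t1 = y \<and> (\<forall>t\<in>A. \<gamma> t \<in> F t) \<and> (\<forall>t. t \<notin> A \<longrightarrow> \<gamma> t = y) \<and>
    (\<forall>s\<in>A. \<forall>t\<in>A. s \<le> t \<longrightarrow> dist (\<gamma> s) (\<gamma> t) \<le> v t - v s)"
proof -
  define K where "K t = (if t \<in> A \<and> t \<noteq> t1 then F t else {y})" for t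
  define P where "P = {(s, t). s \<in> A \<and> t \<in> A \<and> s \<le> t}"
  define C where "C = (\<lambda>(s, t). {\<gamma> :: real \<Rightarrow> 'a. dist (\<gamma> s) (\<gamma> t) \<le> v t - v s})"
  have "{\<gamma>. \<forall>t. \<gamma> t \<in> K t} \<inter> \<Inter>(C ` P) \<noteq> {}"
  proof (rule compact_imp_fip_image)
    show "compact {\<gamma>. \<forall>t. \<gamma> t \<in> K t}"
      using F by (intro compact_product) (auto simp: K_def nonempty_compacts_def Pi_iff)
    show "closed (C i)" if "i \<in> P" for i
      by (cases i) (simp add: C_def closed_dist_le)
    fix Q assume Q: "finite Q" "Q \<subseteq> P"
    define E where "E = fst ` Q \<union> snd ` Q"
    have E: "finite E" "E \<subseteq> A" using Q by (auto simp: E_def P_def)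
    obtain \<gamma> where \<gamma>: "\<gamma> t1 = y" "\<forall>t\<in>A. \<gamma> t \<in> F t"
      "\<forall>s\<in>insert t1 E. \<forall>t\<in>insert t1 E. s \<le> t \<longrightarrow> dist (\<gamma> s) (\<gamma> t) \<le> v t - v s"
      using finite_chain_selection[OF F least potential y E] by blast
    define \<gamma>' where "\<gamma>' t = (if t \<in> A then \<gamma> t else y)" for t
    have "\<gamma>' \<in> C i" if "i \<in> Q" for i
    proof -
      obtain s t where i: "i = (s, t)" by (cases i)
      then have st: "s \<in> E" "t \<in> E" "s \<le> t" "s \<in> A" "t \<in> A"
        using that Q by (force simp: E_def P_def)+
      then show ?thesis using \<gamma>(3) by (simp add: i C_def \<gamma>'_def)
    qed
    moreover have "\<gamma>' t \<in> K t" for t using \<gamma> least by (auto simp: \<gamma>'_def K_def)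
    ultimately show "{\<gamma>. \<forall>t. \<gamma> t \<in> K t} \<inter> (\<Inter>i\<in>Q. C i) \<noteq> {}" by blast
  qed
  then obtain \<gamma> where \<gamma>: "\<forall>t. \<gamma> t \<in> K t" "\<forall>i\<in>P. \<gamma> \<in> C i" by auto
  have K: "\<gamma> t \<in> K t" for t using \<gamma> by blast
  have "\<gamma> t \<in> F t" if "t \<in> A" for t
    using K[of t] that y by (auto simp: K_def split: if_splits)
  moreover have "\<gamma> t = y" if "t \<notin> A \<or> t = t1" for t
    using K[of t] that by (auto simp: K_def split: if_splits)
  moreover have "dist (\<gamma> s) (\<gamma> t) \<le> v t - v s" if "s \<in> A" "t \<in> A" "s \<le> t" for s t
    using \<gamma>(2) that by (auto simp: P_def C_def)
  ultimately show ?thesis by blast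
qed

text \<open>
The value \<open>\<Gamma> t\<close> collects the values at \<open>t\<close> of all admissible point selections. Because a selection
through a point at one time also passes close to it at any other time, earlier or later, the bound
on the excess of \<open>F\<close> becomes one on the symmetric distance for \<open>\<Gamma>\<close>.
\<close>

lemma set_valued_selection:
  fixes F :: "real \<Rightarrow> 'a::metric_space set"
  assumes F: "F \<in> A \<rightarrow> nonempty_compacts"
    and least: "t1 \<in> A" "\<And>t. t \<in> A \<Longrightarrow> t1 \<le> t"
    and potential: "\<And>s t. s \<in> A \<Longrightarrow> t \<in> A \<Longrightarrow> s \<le> t \<Longrightarrow> excess (F s) (F t) \<le> v t - v s"
    and X0: "X0 \<in> nonempty_compacts"
  obtains \<Gamma> where "set_valued_selector A F \<Gamma>"
    "hausdorff_distance X0 (\<Gamma> t1) \<le> excess X0 (F t1)"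
    "\<And>s t. s \<in> A \<Longrightarrow> t \<in> A \<Longrightarrow> s \<le> t \<Longrightarrow> hausdorff_distance (\<Gamma> s) (\<Gamma> t) \<le> v t - v s"
proof -
  have F1: "F t1 \<in> nonempty_compacts" using F least by auto
  \<comment> \<open>The largest set of initial points compatible with the bound at t1. It contains a nearest point
    to each point of X0, and hence its distance from X0 in both directions is under control.\<close>
  define Y where "Y = {y \<in> F t1. infdist y X0 \<le> excess X0 (F t1)}"
  have nearest: "\<exists>y\<in>Y. dist x y \<le> excess X0 (F t1)" if x: "x \<in> X0" for x
  proof -
    obtain y where y: "y \<in> F t1" "infdist x (F t1) = dist x y"
      using nearest_point[OF F1] .
    then have "dist x y \<le> excess X0 (F t1)" using infdist_le_excess[OF X0 x, of "F t1"] by simp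
    then show ?thesis
      using y infdist_le[OF x, of y] by (auto simp: Y_def dist_commute intro!: bexI[of _ y])
  qed
  have "Y = F t1 \<inter> {y. infdist y X0 \<le> excess X0 (F t1)}" by (auto simp: Y_def)
  moreover have "closed {y. infdist y X0 \<le> excess X0 (F t1)}"
    by (intro closed_Collect_le continuous_intros)
  ultimately have "compact Y" using F1 by (auto simp: nonempty_compacts_def)
  moreover have "Y \<noteq> {}" using X0 nearest by (auto simp: nonempty_compacts_def)
  ultimately have Y: "Y \<in> nonempty_compacts" by (simp add: nonempty_compacts_def)
  \<comment> \<open>Outside A any compact nonempty factor will do.\<close>
  define K where "K t = (if t \<in> A \<and> t \<noteq> t1 then F t else Y)" for t
  define S where "S = {\<gamma>. \<forall>t. \<gamma> t \<in> K t} \<inter>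
    (\<Inter>(s, t)\<in>{(s, t). s \<in> A \<and> t \<in> A \<and> s \<le> t}. {\<gamma>. dist (\<gamma> s) (\<gamma> t) \<le> v t - v s})"
  have "compact S" unfolding S_def
    using F Y by (intro compact_Int_closed compact_product closed_INT)
      (auto simp: K_def nonempty_compacts_def Pi_iff closed_dist_le)
  have S: "\<exists>\<gamma>\<in>S. \<gamma> t1 = y" if "y \<in> Y" for y
  proof -
    have "y \<in> F t1" using that by (simp add: Y_def)
    from point_selection[OF F least potential this] obtain \<gamma> where
      "\<gamma> t1 = y" "\<forall>t\<in>A. \<gamma> t \<in> F t" "\<forall>t. t \<notin> A \<longrightarrow> \<gamma> t = y"
      "\<forall>s\<in>A. \<forall>t\<in>A. s \<le> t \<longrightarrow> dist (\<gamma> s) (\<gamma> t) \<le> v t - v s" by blast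
    then show ?thesis using that by (intro bexI[of _ \<gamma>]) (auto simp: S_def K_def)
  qed
  define \<Gamma> where "\<Gamma> t = (\<lambda>\<gamma>. \<gamma> t) ` S" for t
  have "S \<noteq> {}" using S \<open>Y \<noteq> {}\<close> by blast
  moreover have "compact (\<Gamma> t)" for t
    unfolding \<Gamma>_def using \<open>compact S\<close>
    by (intro compact_continuous_image continuous_on_subset[OF continuous_on_product_coordinates]) auto
  ultimately have \<Gamma>: "\<Gamma> t \<in> nonempty_compacts" for t
    by (auto simp: nonempty_compacts_def \<Gamma>_def)
  \<comment> \<open>Every initial point is attained, because a selection can be started at each of them.\<close>
  have "\<Gamma> t1 = Y"
  proof
    show "\<Gamma> t1 \<subseteq> Y" by (auto simp: \<Gamma>_def S_def K_def dest!: spec[of _ t1])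
    show "Y \<subseteq> \<Gamma> t1" using S by (force simp: \<Gamma>_def)
  qed
  have "K t \<subseteq> F t" if "t \<in> A" for t using that by (auto simp: K_def Y_def)
  then have "set_valued_selector A F \<Gamma>"
    using \<Gamma> by (fastforce simp: set_valued_selector_def \<Gamma>_def S_def)
  moreover have "hausdorff_distance X0 (\<Gamma> t1) \<le> excess X0 (F t1)"
    unfolding \<open>\<Gamma> t1 = Y\<close>
  proof (rule hausdorff_distance_le[OF X0 Y nearest])
    fix y assume y: "y \<in> Y"
    obtain x where "x \<in> X0" "infdist y X0 = dist y x" using nearest_point[OF X0] .
    then show "\<exists>x\<in>X0. dist x y \<le> excess X0 (F t1)" using y by (auto simp: Y_def dist_commute)
  qed
  moreover have "hausdorff_distance (\<Gamma> s) (\<Gamma> t) \<le> v t - v s"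
    if "s \<in> A" "t \<in> A" "s \<le> t" for s t
    using that by (intro hausdorff_distance_le \<Gamma>) (auto simp: \<Gamma>_def S_def)
  ultimately show ?thesis by (rule that)
qed

section \<open>Functions of bounded variation\<close>

lemma jordan_variation_nonneg: "0 \<le> jordan_variation G A"
  by (simp add: jordan_variation_def variation_nonneg)

lemma jordan_variation_mono: "A \<subseteq> B \<Longrightarrow> jordan_variation G A \<le> jordan_variation G B"
  by (simp add: jordan_variation_def variation_mono)

lemma jordan_variation_real:
  assumes "jordan_variation G T < \<infinity>" "A \<subseteq> T"
  shows "jordan_variation G A = ereal (real_of_ereal (jordan_variation G A))"
  using jordan_variation_mono[OF assms(2), of G] jordan_variation_nonneg[of G A] assms(1)
  by (cases "jordan_variation G A") auto

lemma jordan_variation_potential: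
  assumes G: "G \<in> A \<rightarrow> nonempty_compacts" and fin: "jordan_variation G A = ereal q"
  obtains v where
    "\<And>s t. s \<in> A \<Longrightarrow> t \<in> A \<Longrightarrow> s \<le> t \<Longrightarrow> hausdorff_distance (G s) (G t) \<le> v t - v s"
    "\<And>t. 0 \<le> v t \<and> v t \<le> q"
proof (rule variation_potential[of A hausdorff_distance G q])
  show "0 \<le> hausdorff_distance (G s) (G t)" if "s \<in> A" for s t
    using G that by (auto intro: hausdorff_distance_nonneg)
qed (use fin that in \<open>auto simp: jordan_variation_def\<close>)

lemma potential_mono:
  assumes "G \<in> A \<rightarrow> nonempty_compacts"
    and "\<And>s t. s \<in> A \<Longrightarrow> t \<in> A \<Longrightarrow> s \<le> t \<Longrightarrow> hausdorff_distance (G s) (G t) \<le> v t - v s"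
  shows "mono_on A v"
proof (rule mono_onI)
  fix s t assume "s \<in> A" "t \<in> A" "s \<le> t"
  then show "v s \<le> v t"
    using assms(2)[of s t] hausdorff_distance_nonneg[of "G s" "G t"] assms(1) by (auto dest: Pi_mem)
qed

text \<open>
Splitting a step at \<open>p\<close> does not lower its cost, by the triangle inequality. In terms of potentials: a
potential for the part before \<open>p\<close> and one for the part after it, shifted up by the bound of the
first, together form a potential for the whole set.
\<close>

lemma jordan_variation_split:
  assumes G: "G \<in> A \<rightarrow> nonempty_compacts" and p: "p \<in> A"
  shows "jordan_variation G A \<le> jordan_variation G (A \<inter> {..p}) + jordan_variation G (A \<inter> {p..})"
proof (cases "jordan_variation G (A \<inter> {..p}) = \<infinity> \<or> jordan_variation G (A \<inter> {p..}) = \<infinity>")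
  case True
  then show ?thesis by auto
next
  case False
  then obtain q r where q: "jordan_variation G (A \<inter> {..p}) = ereal q"
    and r: "jordan_variation G (A \<inter> {p..}) = ereal r"
    using jordan_variation_nonneg[of G "A \<inter> {..p}"] jordan_variation_nonneg[of G "A \<inter> {p..}"]
    by (cases "jordan_variation G (A \<inter> {..p})"; cases "jordan_variation G (A \<inter> {p..})") auto
  obtain v where v: "\<And>s t. s \<in> A \<inter> {..p} \<Longrightarrow> t \<in> A \<inter> {..p} \<Longrightarrow> s \<le> t \<Longrightarrow>
      hausdorff_distance (G s) (G t) \<le> v t - v s" "\<And>t. 0 \<le> v t \<and> v t \<le> q"
    using jordan_variation_potential[OF _ q] G by auto
  obtain w where w: "\<And>s t. s \<in> A \<inter> {p..} \<Longrightarrow> t \<in> A \<inter> {p..} \<Longrightarrow> s \<le> t \<Longrightarrow>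
      hausdorff_distance (G s) (G t) \<le> w t - w s" "\<And>t. 0 \<le> w t \<and> w t \<le> r"
    using jordan_variation_potential[OF _ r] G by auto
  have "variation_wrt hausdorff_distance G A \<le> ereal (q + r - 0)"
  proof (rule variation_le_potential[where v = "\<lambda>t. if t \<le> p then v t else q + w t"])
    fix s t assume st: "s \<in> A" "t \<in> A" "s \<le> t"
    consider "t \<le> p" | "p < s" | "s \<le> p" "p < t" by linarith
    then show "hausdorff_distance (G s) (G t)
        \<le> (if t \<le> p then v t else q + w t) - (if s \<le> p then v s else q + w s)"
    proof cases
      case 3
      have "hausdorff_distance (G s) (G t)
          \<le> hausdorff_distance (G s) (G p) + hausdorff_distance (G p) (G t)"
        using G st p by (intro hausdorff_distance_triangle) auto
      also have "\<dots> \<le> (v p - v s) + (w t - w p)"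
        using 3 st p by (intro add_mono v w) auto
      also have "\<dots> \<le> q + w t - v s" using v(2)[of p] w(2)[of p] by simp
      finally show ?thesis using 3 by simp
    qed (use st v(1)[of s t] w(1)[of s t] in auto)
  next
    fix t show "0 \<le> (if t \<le> p then v t else q + w t) \<and> (if t \<le> p then v t else q + w t) \<le> q + r"
      using v(2)[of t] w(2)[of t] by auto
    show "0 \<le> q + r" using v(2)[of p] w(2)[of p] by linarith
  qed
  then show ?thesis using q r by (simp add: jordan_variation_def)
qed

text \<open>
Adding a last point \<open>t0\<close> costs the step from \<open>t\<close> to \<open>t0\<close> and at most twice the oscillation of the
potential: once for the variation before \<open>t0\<close>, and once for comparing the jump from \<open>s\<close> to \<open>t0\<close>
with the jump from \<open>t\<close> to \<open>t0\<close>. With \<open>t\<close> the first time this shows that a single jump preserves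
bounded variation; as \<open>t\<close> tends to \<open>t0\<close> from the left it shows that the variation on \<open>[t, t0]\<close> is
asymptotically the jump.
\<close>

lemma jordan_variation_last_point:
  assumes G: "G \<in> T \<rightarrow> nonempty_compacts" and T: "t \<in> T" "t0 \<in> T" "t < t0"
    and v: "\<And>s r. s \<in> T \<inter> {t..<t0} \<Longrightarrow> r \<in> T \<inter> {t..<t0} \<Longrightarrow> s \<le> r \<Longrightarrow>
      hausdorff_distance (G s) (G r) \<le> v r - v s"
    and M: "\<And>s. s \<in> T \<inter> {t..<t0} \<Longrightarrow> v s \<le> M"
  shows "jordan_variation G (T \<inter> {t..t0}) \<le> ereal (2 * (M - v t) + hausdorff_distance (G t) (G t0))"
proof -
  let ?h = "hausdorff_distance (G t) (G t0)"
  have mono: "mono_on (T \<inter> {t..<t0}) v"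
    using G v by (intro potential_mono[of G]) auto
  then have vt: "v t \<le> v s" if "s \<in> T \<inter> {t..<t0}" for s
    using that T by (auto dest!: mono_onD[of _ v t s])
  have h: "0 \<le> ?h" using G T by (auto intro: hausdorff_distance_nonneg)
  \<comment> \<open>The value at t0 is large enough to dominate the step from any s before t0, as this step is at
    most (v s - v t) + ?h and v s is at most M.\<close>
  have "variation_wrt hausdorff_distance G (T \<inter> {t..t0}) \<le> ereal ((2 * M - v t + ?h) - v t)"
  proof (rule variation_le_potential[where v = "\<lambda>s. if s < t0 then v s else 2 * M - v t + ?h"])
    fix s r assume sr: "s \<in> T \<inter> {t..t0}" "r \<in> T \<inter> {t..t0}" "s \<le> r"
    consider "r < t0" | "s = t0" "r = t0" | "s < t0" "r = t0" using sr by force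
    then show "hausdorff_distance (G s) (G r)
      \<le> (if r < t0 then v r else 2 * M - v t + ?h) - (if s < t0 then v s else 2 * M - v t + ?h)"
    proof cases
      case 1
      then show ?thesis using sr v[of s r] by auto
    next
      case 2
      then show ?thesis using G T by (auto simp: hausdorff_distance_self Pi_iff)
    next
      case 3
      have "hausdorff_distance (G s) (G r) \<le> hausdorff_distance (G s) (G t) + hausdorff_distance (G t) (G r)"
        using G sr T by (intro hausdorff_distance_triangle) auto
      also have "\<dots> \<le> (v s - v t) + ?h"
        using v[of t s] 3 sr T by (simp add: hausdorff_distance_commute)
      also have "\<dots> \<le> 2 * M - v t + ?h - v s" using M[of s] 3 sr by auto
      finally show ?thesis using 3 by simp
    qed
  next
    fix s assume "s \<in> T \<inter> {t..t0}"
    then show "v t \<le> (if s < t0 then v s else 2 * M - v t + ?h) \<and>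
      (if s < t0 then v s else 2 * M - v t + ?h) \<le> 2 * M - v t + ?h"
      using vt[of s] M[of s] M[of t] T h by auto
  next
    show "v t \<le> 2 * M - v t + ?h" using M[of t] T h by auto
  qed
  then show ?thesis by (simp add: jordan_variation_def algebra_simps)
qed

lemma bounded_variation_glue:
  assumes G: "G \<in> T \<rightarrow> nonempty_compacts" and T: "a \<in> T" "t0 \<in> T" "a < t0" "\<And>t. t \<in> T \<Longrightarrow> a \<le> t"
    and left: "jordan_variation G (T \<inter> {a..<t0}) < \<infinity>"
    and right: "jordan_variation G (T \<inter> {t0..}) < \<infinity>"
  shows "jordan_variation G T < \<infinity>"
proof -
  obtain q where q: "jordan_variation G (T \<inter> {a..<t0}) = ereal q"
    using jordan_variation_real[OF left order.refl] by metis
  obtain v where v: "\<And>s t. s \<in> T \<inter> {a..<t0} \<Longrightarrow> t \<in> T \<inter> {a..<t0} \<Longrightarrow> s \<le> t \<Longrightarrow>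
      hausdorff_distance (G s) (G t) \<le> v t - v s" "\<And>t. 0 \<le> v t \<and> v t \<le> q"
    using jordan_variation_potential[OF _ q] G by auto
  have "jordan_variation G (T \<inter> {a..t0}) < \<infinity>"
    using jordan_variation_last_point[OF G T(1-3) v(1), of q] v(2) by auto
  moreover have "T \<inter> {..t0} = T \<inter> {a..t0}" using T(4) by auto
  ultimately show ?thesis
    using jordan_variation_split[OF G T(2)] right by auto
qed

section \<open>The jump at a point\<close>

lemma mono_tendsto_Sup_left:
  fixes f :: "real \<Rightarrow> real"
  assumes mono: "mono_on S f" and bdd: "bdd_above (f ` S)" and S: "S \<noteq> {}" "\<And>t. t \<in> S \<Longrightarrow> t < s"
  shows "(f \<longlongrightarrow> Sup (f ` S)) (at s within S)"
proof (rule order_tendstoI)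
  have in_S: "\<forall>\<^sub>F t in at s within S. t \<in> S" by (simp add: eventually_at_filter)
  fix u assume "u < Sup (f ` S)"
  then obtain x where x: "x \<in> S" "u < f x" using S bdd by (auto simp: less_cSup_iff)
  have "\<forall>\<^sub>F t in at s within S. x < t"
    using order_tendstoD(1)[OF tendsto_ident_at S(2)[OF x(1)]] .
  with in_S show "\<forall>\<^sub>F t in at s within S. u < f t"
    by eventually_elim (use x mono in \<open>auto dest!: mono_onD[of S f x]\<close>)
next
  fix u assume u: "Sup (f ` S) < u"
  have in_S: "\<forall>\<^sub>F t in at s within S. t \<in> S" by (simp add: eventually_at_filter)
  then show "\<forall>\<^sub>F t in at s within S. f t < u"
    by eventually_elim (use u bdd in \<open>meson cSup_upper imageI le_less_trans\<close>)
qed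

lemma at_within_Sup_neq_bot:
  fixes B :: "real set"
  assumes "B \<noteq> {}" "bdd_above B" "Sup B \<notin> B"
  shows "at (Sup B) within B \<noteq> bot"
proof -
  have "Sup B \<in> closure (B - {Sup B})"
    using closure_contains_Sup[OF assms(1,2)] assms(3) by simp
  then show ?thesis by (simp add: at_within_eq_bot_iff)
qed

text \<open>
The middle part overlaps the first one in \<open>[t, t0)\<close>. This makes the first part independent of
\<open>t\<close>, so that only the middle term changes when \<open>t\<close> tends to \<open>s0\<close>.
\<close>

lemma jordan_variation_le_split3:
  assumes G: "G \<in> T \<rightarrow> nonempty_compacts"
    and T: "\<And>t. t \<in> T \<Longrightarrow> a \<le> t" "t0 \<in> T" "t \<in> T \<inter> {a..<t0}"
  shows "jordan_variation G T \<le> jordan_variation G (T \<inter> {a..<t0})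
    + jordan_variation G (T \<inter> {t..t0}) + jordan_variation G (T \<inter> {t0..})"
proof -
  have "jordan_variation G T \<le> jordan_variation G (T \<inter> {..t}) + jordan_variation G (T \<inter> {t..})"
    using T by (intro jordan_variation_split[OF G]) auto
  also have "jordan_variation G (T \<inter> {..t}) \<le> jordan_variation G (T \<inter> {a..<t0})"
    using T by (intro jordan_variation_mono) auto
  also have "jordan_variation G (T \<inter> {t..}) \<le>
      jordan_variation G (T \<inter> {t..} \<inter> {..t0}) + jordan_variation G (T \<inter> {t..} \<inter> {t0..})"
    using G T by (intro jordan_variation_split) auto
  also have "T \<inter> {t..} \<inter> {..t0} = T \<inter> {t..t0}" by auto
  also have "T \<inter> {t..} \<inter> {t0..} = T \<inter> {t0..}" using T by auto
  finally show ?thesis by (simp add: add.assoc add_mono)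
qed

text \<open>
The variation on \<open>[t, t0]\<close> decreases in \<open>t\<close> and is nonnegative and finite, so it has a limit. The
one-sided neighbourhood of \<open>s0\<close> is nontrivial because the supremum is not attained; otherwise the
limit in the definition of \<^const>\<open>J_left\<close> would not be determined.
\<close>

lemma jump_limit:
  assumes G: "G \<in> T \<rightarrow> nonempty_compacts" and BV: "jordan_variation G T < \<infinity>"
    and T: "a \<in> T" "t0 \<in> T" "a < t0" "\<And>t. t \<in> T \<Longrightarrow> a \<le> t"
    and s0: "s0 = Sup (T \<inter> {a..<t0})" "s0 \<notin> T \<inter> {a..<t0}"
  obtains h L where "\<And>t. jordan_variation G (T \<inter> {t..t0}) = ereal (h t)"
    "(h \<longlongrightarrow> L) (at s0 within (T \<inter> {..<s0}))" "J_left T a G t0 = ereal L"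
    "T \<inter> {..<s0} = T \<inter> {a..<t0}" "at s0 within (T \<inter> {..<s0}) \<noteq> bot"
proof -
  have B: "T \<inter> {a..<t0} \<noteq> {}" "bdd_above (T \<inter> {a..<t0})" using T by (auto intro!: bdd_aboveI2)
  have s0_le: "s0 \<le> t0" unfolding s0 using B by (intro cSup_least) auto
  have s0_less: "t < s0" if "t \<in> T \<inter> {a..<t0}" for t
    using cSup_upper[OF that B(2)] that s0 by (cases "t = s0") auto
  have eq: "T \<inter> {..<s0} = T \<inter> {a..<t0}" using s0_less s0_le T(4) by auto
  have nbot: "at s0 within (T \<inter> {..<s0}) \<noteq> bot"
    unfolding eq using at_within_Sup_neq_bot[OF B] s0 by simp
  define h where "h t = real_of_ereal (jordan_variation G (T \<inter> {t..t0}))" for t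
  have h: "jordan_variation G (T \<inter> {t..t0}) = ereal (h t)" for t
    unfolding h_def by (rule jordan_variation_real[OF BV]) auto
  have h0: "0 \<le> h t" for t using jordan_variation_nonneg[of G "T \<inter> {t..t0}"] by (simp add: h)
  have anti: "h t \<le> h s" if "s \<le> t" for s t
  proof -
    have "T \<inter> {t..t0} \<subseteq> T \<inter> {s..t0}" using that by auto
    from jordan_variation_mono[OF this, of G] show ?thesis by (simp add: h)
  qed
  define L where "L = - Sup ((\<lambda>t. - h t) ` (T \<inter> {..<s0}))"
  have "((\<lambda>t. - h t) \<longlongrightarrow> - L) (at s0 within (T \<inter> {..<s0}))"
    unfolding L_def minus_minus
    by (rule mono_tendsto_Sup_left) (use anti h0 B eq in \<open>auto intro!: mono_onI bdd_aboveI2[where M=0]\<close>)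
  then have L: "(h \<longlongrightarrow> L) (at s0 within (T \<inter> {..<s0}))" by (rule tendsto_minus_cancel)
  then have "((\<lambda>t. ereal (h t)) \<longlongrightarrow> ereal L) (at s0 within (T \<inter> {..<s0}))" by simp
  then have "Lim (at s0 within (T \<inter> {..<s0})) (\<lambda>t. ereal (h t)) = ereal L"
    by (rule tendsto_Lim[OF nbot])
  then have "J_left T a G t0 = ereal L"
    unfolding J_left_def Let_def h s0(1)[symmetric] using s0(2) T(3) by auto
  then show ?thesis using that h L eq nbot by blast
qed

text \<open>
The variation on \<open>[t, t0]\<close> bounds what is missing from the two halves, for every \<open>t\<close> before \<open>t0\<close>.
If there is a last such \<open>t\<close>, it is the distance across the gap; otherwise one lets \<open>t\<close> increase to
\<open>s0\<close>.
\<close>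

lemma jordan_variation_minus_jump:
  assumes G: "G \<in> T \<rightarrow> nonempty_compacts" and BV: "jordan_variation G T < \<infinity>"
    and T: "a \<in> T" "t0 \<in> T" "\<And>t. t \<in> T \<Longrightarrow> a \<le> t"
  shows "jordan_variation G T - J_left T a G t0
    \<le> jordan_variation G (T \<inter> {a..<t0}) + jordan_variation G (T \<inter> {t0..})"
proof (cases "t0 = a")
  case True
  then have "T \<inter> {t0..} = T" using T by auto
  then show ?thesis using True jordan_variation_nonneg[of G "T \<inter> {a..<t0}"]
    by (simp add: J_left_def add_increasing)
next
  case False
  then have less: "a < t0" using T by force
  define s0 where "s0 = Sup (T \<inter> {a..<t0})"
  obtain x where x: "jordan_variation G T = ereal x"
    using jordan_variation_real[OF BV order.refl] by metis
  obtain y where y: "jordan_variation G (T \<inter> {a..<t0}) = ereal y"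
    using jordan_variation_real[OF BV, of "T \<inter> {a..<t0}"] by blast
  obtain z where z: "jordan_variation G (T \<inter> {t0..}) = ereal z"
    using jordan_variation_real[OF BV, of "T \<inter> {t0..}"] by blast
  show ?thesis
  proof (cases "s0 \<in> T \<inter> {a..<t0}")
    case True
    have upper: "t \<le> s0" if "t \<in> T \<inter> {a..<t0}" for t
      unfolding s0_def by (rule cSup_upper[OF that]) (auto intro!: bdd_aboveI2)
    have "T \<inter> {s0..t0} \<subseteq> {s0, t0}" using upper T True by force
    then have "jordan_variation G (T \<inter> {s0..t0}) \<le> jordan_variation G {s0, t0}"
      by (rule jordan_variation_mono)
    also have "\<dots> \<le> ereal (hausdorff_distance (G s0) (G t0) - 0)"
      unfolding jordan_variation_def
      using True G T hausdorff_distance_nonneg[of "G s0" "G t0"]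
      by (intro variation_le_potential[where v = "\<lambda>t. if t = s0 then 0 else hausdorff_distance (G s0) (G t0)"])
        (auto simp: hausdorff_distance_self Pi_iff)
    finally have "jordan_variation G (T \<inter> {s0..t0}) \<le> ereal (hausdorff_distance (G s0) (G t0))" by simp
    then have "ereal y + jordan_variation G (T \<inter> {s0..t0}) + ereal z
        \<le> ereal y + ereal (hausdorff_distance (G s0) (G t0)) + ereal z"
      by (intro add_mono order.refl)
    with jordan_variation_le_split3[OF G T(3) T(2) True]
    have "jordan_variation G T \<le> ereal y + ereal (hausdorff_distance (G s0) (G t0)) + ereal z"
      unfolding y z by (rule order_trans)
    moreover have "J_left T a G t0 = ereal (hausdorff_distance (G s0) (G t0))"
      using False True by (simp add: J_left_def s0_def Let_def)
    ultimately show ?thesis by (simp add: x y z)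
  next
    case False
    obtain h L where h: "\<And>t. jordan_variation G (T \<inter> {t..t0}) = ereal (h t)"
      and lim: "(h \<longlongrightarrow> L) (at s0 within (T \<inter> {..<s0}))" and J: "J_left T a G t0 = ereal L"
      and eq: "T \<inter> {..<s0} = T \<inter> {a..<t0}" and nbot: "at s0 within (T \<inter> {..<s0}) \<noteq> bot"
      using jump_limit[OF G BV T(1,2) less T(3) s0_def False] by metis
    have "x - y - z \<le> h t" if "t \<in> T \<inter> {a..<t0}" for t
      using jordan_variation_le_split3[OF G T(3) T(2) that] by (simp add: x y z h)
    then have "\<forall>\<^sub>F t in at s0 within (T \<inter> {..<s0}). x - y - z \<le> h t"
      by (auto simp: eventually_at_filter eq)
    then have "x - y - z \<le> L" by (rule tendsto_lowerbound[OF lim _ nbot])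
    then show ?thesis by (simp add: x y z J)
  qed
qed

text \<open>
The distance between \<open>G t\<close> and \<open>G t0\<close> is squeezed between the variation on \<open>[t, t0]\<close> and the same
quantity minus twice the oscillation of the potential on \<open>[t, t0)\<close>. The latter tends to zero since
the potential is monotone and bounded.
\<close>

lemma jump_at_limit_point:
  assumes G: "G \<in> T \<rightarrow> nonempty_compacts" and BV: "jordan_variation G T < \<infinity>"
    and T: "a \<in> T" "t0 \<in> T" "a < t0" "\<And>t. t \<in> T \<Longrightarrow> a \<le> t"
    and Sup: "Sup (T \<inter> {a..<t0}) = t0"
  shows "\<exists>L. ((\<lambda>t. hausdorff_distance (G t) (G t0)) \<longlongrightarrow> L) (at t0 within (T \<inter> {..<t0})) \<and>
    J_left T a G t0 = ereal L"
proof -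
  define B where "B = T \<inter> {a..<t0}"
  have "t0 = Sup (T \<inter> {a..<t0})" "t0 \<notin> T \<inter> {a..<t0}" using Sup by auto
  then obtain h L where h: "\<And>t. jordan_variation G (T \<inter> {t..t0}) = ereal (h t)"
    and lim: "(h \<longlongrightarrow> L) (at t0 within (T \<inter> {..<t0}))" and J: "J_left T a G t0 = ereal L"
    and eq: "T \<inter> {..<t0} = T \<inter> {a..<t0}"
    using jump_limit[OF G BV T] by metis
  have eqB: "T \<inter> {..<t0} = B" by (simp add: eq B_def)
  have GB: "G \<in> B \<rightarrow> nonempty_compacts" using G by (auto simp: B_def)
  obtain q where q: "jordan_variation G B = ereal q"
    using jordan_variation_real[OF BV, of B] unfolding B_def by blast
  obtain v where v: "\<And>s t. s \<in> B \<Longrightarrow> t \<in> B \<Longrightarrow> s \<le> t \<Longrightarrow> hausdorff_distance (G s) (G t) \<le> v t - v s"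
    "\<And>t. 0 \<le> v t \<and> v t \<le> q"
    using jordan_variation_potential[OF GB q] by blast
  define M where "M = Sup (v ` B)"
  have bdd: "bdd_above (v ` B)" using v(2) by (auto intro!: bdd_aboveI2)
  have M: "v t \<le> M" if "t \<in> B" for t unfolding M_def using that bdd by (auto intro: cSup_upper)
  have limv: "(v \<longlongrightarrow> M) (at t0 within B)" unfolding M_def
    by (rule mono_tendsto_Sup_left[OF potential_mono[OF GB v(1)] bdd]) (use T in \<open>auto simp: B_def\<close>)
  have lim: "(h \<longlongrightarrow> L) (at t0 within B)" using lim by (simp add: eqB)
  have "((\<lambda>t. h t - 2 * (M - v t)) \<longlongrightarrow> L - 2 * (M - M)) (at t0 within B)"
    by (intro tendsto_intros lim limv)
  then have lower: "((\<lambda>t. h t - 2 * (M - v t)) \<longlongrightarrow> L) (at t0 within B)" by simp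
  have bounds: "h t - 2 * (M - v t) \<le> hausdorff_distance (G t) (G t0) \<and>
      hausdorff_distance (G t) (G t0) \<le> h t" if t: "t \<in> B" for t
  proof
    have "jordan_variation G (T \<inter> {t..t0}) \<le> ereal (2 * (M - v t) + hausdorff_distance (G t) (G t0))"
      by (rule jordan_variation_last_point[OF G]) (use T t v(1) M in \<open>auto simp: B_def\<close>)
    then show "h t - 2 * (M - v t) \<le> hausdorff_distance (G t) (G t0)" by (simp add: h)
    have "ereal (hausdorff_distance (G t) (G t0)) \<le> jordan_variation G (T \<inter> {t..t0})"
      unfolding jordan_variation_def using t T by (intro cost_le_variation) (auto simp: B_def)
    then show "hausdorff_distance (G t) (G t0) \<le> h t" by (simp add: h)
  qed
  have "((\<lambda>t. hausdorff_distance (G t) (G t0)) \<longlongrightarrow> L) (at t0 within B)"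
    by (rule tendsto_sandwich[OF _ _ lower lim]) (use bounds in \<open>auto simp: eventually_at_filter\<close>)
  then show ?thesis using J eqB by auto
qed

section \<open>Selectors of bounded variation\<close>

lemma selector_of_bounded_variation:
  fixes F :: "real \<Rightarrow> 'a::metric_space set"
  assumes F: "F \<in> A \<rightarrow> nonempty_compacts" and fin: "right_variation F A < \<infinity>"
    and least: "t1 \<in> A" "\<And>t. t \<in> A \<Longrightarrow> t1 \<le> t"
    and X0: "X0 \<in> nonempty_compacts"
  obtains \<Gamma> where "set_valued_selector A F \<Gamma>"
    "hausdorff_distance X0 (\<Gamma> t1) \<le> excess X0 (F t1)"
    "jordan_variation \<Gamma> A \<le> right_variation F A"
proof -
  obtain q where q: "variation_wrt excess F A = ereal q"
    using fin variation_nonneg[of excess F A] unfolding right_variation_def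
    by (cases "variation_wrt excess F A") auto
  obtain v where v: "\<And>s t. s \<in> A \<Longrightarrow> t \<in> A \<Longrightarrow> s \<le> t \<Longrightarrow> excess (F s) (F t) \<le> v t - v s"
    "\<And>t. 0 \<le> v t \<and> v t \<le> q"
    using variation_potential[OF _ q] F excess_nonneg by (metis Pi_mem)
  obtain \<Gamma> where \<Gamma>: "set_valued_selector A F \<Gamma>"
    "hausdorff_distance X0 (\<Gamma> t1) \<le> excess X0 (F t1)"
    "\<And>s t. s \<in> A \<Longrightarrow> t \<in> A \<Longrightarrow> s \<le> t \<Longrightarrow> hausdorff_distance (\<Gamma> s) (\<Gamma> t) \<le> v t - v s"
    using set_valued_selection[OF F least v(1) X0] by blast
  have "variation_wrt hausdorff_distance \<Gamma> A \<le> ereal (q - 0)"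
    by (intro variation_le_potential[where v = v] \<Gamma>(3) v(2) order_trans[of 0 "v t1" q]) (use v(2) in auto)
  then have "jordan_variation \<Gamma> A \<le> right_variation F A"
    by (simp add: jordan_variation_def right_variation_def q)
  then show ?thesis using \<Gamma> that by blast
qed

text \<open>
The selectors before \<open>t0\<close> and from \<open>t0\<close> on are built independently, each from its own first time,
and only the second one is steered towards \<open>X0\<close> at \<open>t0\<close>. A finite jump between them keeps the
variation bounded.
\<close>

lemma right_variation_selector:
  fixes T :: "real set" and F :: "real \<Rightarrow> 'a::metric_space set"
  assumes t0: "t0 \<in> T" and X0: "X0 \<in> nonempty_compacts" and F: "F \<in> T \<rightarrow> nonempty_compacts"
    and a: "a \<in> T" "\<And>t. t \<in> T \<Longrightarrow> a \<le> t" and fin: "right_variation F T < \<infinity>"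
  shows "\<exists>\<Gamma>. set_valued_selector T F \<Gamma> \<and> bounded_variation_on T \<Gamma> \<and>
         hausdorff_distance X0 (\<Gamma> t0) \<le> excess X0 (F t0) \<and>
         jordan_variation \<Gamma> (T \<inter> {a..<t0}) \<le> right_variation F (T \<inter> {a..<t0}) \<and>
         jordan_variation \<Gamma> (T \<inter> {t0..}) \<le> right_variation F (T \<inter> {t0..}) \<and>
         (\<forall>s0. t0 > a \<and> s0 = Sup (T \<inter> {a..<t0}) \<and> s0 \<notin> T \<inter> {a..<t0} \<longrightarrow>
           (\<exists>L::real. ((\<lambda>t. jordan_variation \<Gamma> (T \<inter> {t..t0})) \<longlongrightarrow> ereal L)
                        (at s0 within (T \<inter> {..<s0})))) \<and>
         jordan_variation \<Gamma> T - J_left T a \<Gamma> t0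
           \<le> right_variation F (T \<inter> {a..<t0}) + right_variation F (T \<inter> {t0..}) \<and>
         right_variation F (T \<inter> {a..<t0}) + right_variation F (T \<inter> {t0..})
           \<le> right_variation F T \<and>
         (t0 > a \<and> Sup (T \<inter> {a..<t0}) = t0 \<longrightarrow>
           (\<exists>L::real. ((\<lambda>t. hausdorff_distance (\<Gamma> t) (\<Gamma> t0)) \<longlongrightarrow> L)
                        (at t0 within (T \<inter> {..<t0})) \<and>
                      J_left T a \<Gamma> t0 = ereal L))"
proof -
  let ?L = "T \<inter> {a..<t0}" and ?R = "T \<inter> {t0..}"
  have mono: "right_variation F A \<le> right_variation F T" if "A \<subseteq> T" for A
    unfolding right_variation_def by (rule variation_mono[OF that])
  have finL: "right_variation F ?L < \<infinity>" and finR: "right_variation F ?R < \<infinity>"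
    using mono[of ?L] mono[of ?R] fin by auto
  obtain \<Gamma>R where R: "set_valued_selector ?R F \<Gamma>R" "hausdorff_distance X0 (\<Gamma>R t0) \<le> excess X0 (F t0)"
    "jordan_variation \<Gamma>R ?R \<le> right_variation F ?R"
    using selector_of_bounded_variation[OF _ finR _ _ X0, of t0] F t0 by auto
  obtain \<Gamma>L where L: "set_valued_selector ?L F \<Gamma>L" "jordan_variation \<Gamma>L ?L \<le> right_variation F ?L"
  proof (cases "t0 = a")
    case True
    then show ?thesis
      using that by (auto simp: set_valued_selector_def jordan_variation_def right_variation_def variation_empty)
  next
    case False
    then have "a < t0" using a t0 by force
    then show ?thesis
      using selector_of_bounded_variation[OF _ finL _ _ X0, of a] F a that by auto
  qed
  define \<Gamma> where "\<Gamma> t = (if t < t0 then \<Gamma>L t else \<Gamma>R t)" for t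
  have sel: "set_valued_selector T F \<Gamma>"
    using L(1) R(1) a by (auto simp: set_valued_selector_def \<Gamma>_def Pi_iff)
  then have \<Gamma>: "\<Gamma> \<in> T \<rightarrow> nonempty_compacts" by (simp add: set_valued_selector_def)
  have "jordan_variation \<Gamma> ?L = jordan_variation \<Gamma>L ?L" "jordan_variation \<Gamma> ?R = jordan_variation \<Gamma>R ?R"
    unfolding jordan_variation_def by (auto intro!: variation_cong simp: \<Gamma>_def)
  then have VL: "jordan_variation \<Gamma> ?L \<le> right_variation F ?L"
    and VR: "jordan_variation \<Gamma> ?R \<le> right_variation F ?R" using L R by auto
  have BV: "jordan_variation \<Gamma> T < \<infinity>"
  proof (cases "t0 = a")
    case True
    then have "?R = T" using a by auto
    then show ?thesis using VR finR by auto
  next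
    case False
    then have "a < t0" using a t0 by force
    then show ?thesis
      using bounded_variation_glue[OF \<Gamma> a(1) t0 _ a(2)] VL VR finL finR by (meson le_less_trans)
  qed
  have super: "right_variation F ?L + right_variation F ?R \<le> right_variation F T"
  proof -
    have "right_variation F ?L + right_variation F ?R \<le> right_variation F (?L \<union> ?R)"
      unfolding right_variation_def using F by (intro variation_superadditive) (auto intro!: excess_nonneg)
    then show ?thesis using mono[of "?L \<union> ?R"] by (auto intro: order_trans)
  qed
  show ?thesis
  proof (intro exI[of _ \<Gamma>] conjI allI impI; (elim conjE)?)
    show "\<exists>L::real. ((\<lambda>t. jordan_variation \<Gamma> (T \<inter> {t..t0})) \<longlongrightarrow> ereal L) (at s0 within (T \<inter> {..<s0}))"
      if s0: "a < t0" "s0 = Sup ?L" "s0 \<notin> ?L" for s0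
    proof -
      obtain h L where "\<And>t. jordan_variation \<Gamma> (T \<inter> {t..t0}) = ereal (h t)"
        "(h \<longlongrightarrow> L) (at s0 within (T \<inter> {..<s0}))"
        using jump_limit[OF \<Gamma> BV a(1) t0 s0(1) a(2) s0(2,3)] by metis
      then show ?thesis by auto
    qed
    show "jordan_variation \<Gamma> T - J_left T a \<Gamma> t0 \<le> right_variation F ?L + right_variation F ?R"
      using jordan_variation_minus_jump[OF \<Gamma> BV a(1) t0 a(2)] VL VR by (meson add_mono order_trans)
    show "\<exists>L::real. ((\<lambda>t. hausdorff_distance (\<Gamma> t) (\<Gamma> t0)) \<longlongrightarrow> L) (at t0 within (T \<inter> {..<t0})) \<and>
        J_left T a \<Gamma> t0 = ereal L" if "a < t0" "Sup ?L = t0"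
      by (rule jump_at_limit_point[OF \<Gamma> BV a(1) t0 that(1) a(2) that(2)])
    show "hausdorff_distance X0 (\<Gamma> t0) \<le> excess X0 (F t0)" using R by (simp add: \<Gamma>_def)
  qed (use sel BV VL VR super in \<open>auto simp: bounded_variation_on_def\<close>)
qed

section \<open>Time reversal\<close>

text \<open>
Read backwards, a partition of \<open>- A\<close> is a partition of \<open>A\<close>. One inequality is enough, for reversal
is an involution.
\<close>

lemma variation_reverse:
  "variation_wrt c (\<lambda>t. G (- t)) (uminus ` A) = variation_wrt (\<lambda>x y. c y x) G A"
proof -
  have le: "variation_wrt c (\<lambda>t. G (- t)) (uminus ` A) \<le> variation_wrt (\<lambda>x y. c y x) G A"
    for c :: "'c \<Rightarrow> 'c \<Rightarrow> real" and G A
  proof (rule variation_le[OF _ variation_nonneg])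
    fix m \<tau> assume p: "(m, \<tau>) \<in> partitions (uminus ` A)"
    define \<rho> where "\<rho> i = - \<tau> (m - i)" for i
    have \<tau>: "\<tau> i \<in> uminus ` A" if "i \<le> m" for i using p that by (auto simp: partitions_def)
    have "\<rho> (i - 1) \<le> \<rho> i" if i: "i \<in> {1..m}" for i
    proof -
      have "m - (i - 1) \<in> {1..m}" "m - (i - 1) - 1 = m - i" using i by auto
      then have "\<tau> (m - i) \<le> \<tau> (m - (i - 1))" using p unfolding partitions_def by fastforce
      then show ?thesis by (simp add: \<rho>_def)
    qed
    moreover have "\<rho> i \<in> A" if "i \<le> m" for i using \<tau>[of "m - i"] by (auto simp: \<rho>_def)
    ultimately have "(m, \<rho>) \<in> partitions A" by (simp add: partitions_def)
    from partition_sum_le_variation[OF this, of "\<lambda>x y. c y x" G]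
    have "ereal (\<Sum>i=1..m. c (G (\<rho> i)) (G (\<rho> (i - 1)))) \<le> variation_wrt (\<lambda>x y. c y x) G A" .
    moreover have "(\<Sum>i=1..m. c (G (- \<tau> (i - 1))) (G (- \<tau> i))) = (\<Sum>i=1..m. c (G (\<rho> i)) (G (\<rho> (i - 1))))"
      by (subst sum.atLeastAtMost_rev) (auto intro!: sum.cong simp: \<rho>_def Suc_diff_le)
    ultimately show "ereal (\<Sum>i=1..m. c (G (- \<tau> (i - 1))) (G (- \<tau> i))) \<le> variation_wrt (\<lambda>x y. c y x) G A"
      by simp
  qed
  show ?thesis
    using le[of c G A] le[of "\<lambda>x y. c y x" "\<lambda>t. G (- t)" "uminus ` A"] by (simp add: image_image)
qed

lemma jordan_variation_reverse:
  fixes G :: "real \<Rightarrow> 'a::metric_space set"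
  shows
  "jordan_variation (\<lambda>t. G (- t)) (uminus ` A) = jordan_variation G A"
proof -
  have "(\<lambda>X Y :: 'a set. hausdorff_distance Y X) = hausdorff_distance"
    by (intro ext hausdorff_distance_commute)
  then show ?thesis by (simp add: jordan_variation_def variation_reverse)
qed

lemma right_variation_reverse:
  "right_variation (\<lambda>t. F (- t)) (uminus ` A) = left_variation F A"
  unfolding right_variation_def left_variation_def variation_reverse ..

lemma tendsto_reverse:
  fixes S :: "real set"
  shows "(f \<longlongrightarrow> l) (at (- x) within uminus ` S) \<longleftrightarrow> ((\<lambda>t. f (- t)) \<longlongrightarrow> l) (at x within S)"
  by (simp add: tendsto_def eventually_at dist_real_def abs_minus_commute)

text \<open>
In the case without an attained supremum both sides are limits, and they agree because the same
values are limits along both filters.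
\<close>

lemma J_left_reverse:
  "J_left (uminus ` T) (- b) (\<lambda>t. G (- t)) (- t0) = J_right T b G t0"
proof -
  define s0 where "s0 = Inf (T \<inter> {t0<..b})"
  have img: "uminus ` T \<inter> {- b..<- t0} = uminus ` (T \<inter> {t0<..b})" by auto
  then have Sup: "Sup (uminus ` T \<inter> {- b..<- t0}) = - s0" by (simp add: s0_def Inf_real_def)
  have "uminus ` T \<inter> {..<- s0} = uminus ` (T \<inter> {s0<..})" by auto
  moreover have "uminus ` T \<inter> {- t..- t0} = uminus ` (T \<inter> {t0..t})" for t by auto
  ultimately have "Lim (at (- s0) within (uminus ` T \<inter> {..<- s0}))
      (\<lambda>t. jordan_variation (\<lambda>t. G (- t)) (uminus ` T \<inter> {t..- t0})) =
    Lim (at s0 within (T \<inter> {s0<..})) (\<lambda>t. jordan_variation G (T \<inter> {t0..t}))"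
    by (simp add: Topological_Spaces.Lim_def tendsto_reverse jordan_variation_reverse)
  moreover have "- s0 \<in> uminus ` T \<inter> {- b..<- t0} \<longleftrightarrow> s0 \<in> T \<inter> {t0<..b}" by auto
  ultimately show ?thesis
    unfolding J_left_def J_right_def Let_def Sup s0_def[symmetric]
    by (simp add: hausdorff_distance_commute)
qed

text \<open>
This is the previous existence result for the reversed family \<open>\<lambda>t. F (- t)\<close> on \<open>- T\<close>, whose least
point is \<open>- b\<close>.
\<close>

lemma left_variation_selector:
  fixes T :: "real set" and F :: "real \<Rightarrow> 'a::metric_space set"
  assumes t0: "t0 \<in> T" and X0: "X0 \<in> nonempty_compacts" and F: "F \<in> T \<rightarrow> nonempty_compacts"
    and b: "b \<in> T" "\<And>t. t \<in> T \<Longrightarrow> t \<le> b" and fin: "left_variation F T < \<infinity>"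
  shows "\<exists>\<Gamma>. set_valued_selector T F \<Gamma> \<and> bounded_variation_on T \<Gamma> \<and>
         hausdorff_distance X0 (\<Gamma> t0) \<le> excess X0 (F t0) \<and>
         jordan_variation \<Gamma> (T \<inter> {t0<..b}) \<le> left_variation F (T \<inter> {t0<..b}) \<and>
         jordan_variation \<Gamma> (T \<inter> {..t0}) \<le> left_variation F (T \<inter> {..t0}) \<and>
         (\<forall>s0. t0 < b \<and> s0 = Inf (T \<inter> {t0<..b}) \<and> s0 \<notin> T \<inter> {t0<..b} \<longrightarrow>
           (\<exists>L::real. ((\<lambda>t. jordan_variation \<Gamma> (T \<inter> {t0..t})) \<longlongrightarrow> ereal L)
                        (at s0 within (T \<inter> {s0<..})))) \<and>
         jordan_variation \<Gamma> T - J_right T b \<Gamma> t0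
           \<le> left_variation F (T \<inter> {t0<..b}) + left_variation F (T \<inter> {..t0}) \<and>
         left_variation F (T \<inter> {t0<..b}) + left_variation F (T \<inter> {..t0})
           \<le> left_variation F T \<and>
         (t0 < b \<and> Inf (T \<inter> {t0<..b}) = t0 \<longrightarrow>
           (\<exists>L::real. ((\<lambda>t. hausdorff_distance (\<Gamma> t0) (\<Gamma> t)) \<longlongrightarrow> L)
                        (at t0 within (T \<inter> {t0<..})) \<and>
                      J_right T b \<Gamma> t0 = ereal L))"
proof -
  let ?T = "uminus ` T" and ?F = "\<lambda>t. F (- t)"
  have img: "?T \<inter> {- b..<- t0} = uminus ` (T \<inter> {t0<..b})" "?T \<inter> {- t0..} = uminus ` (T \<inter> {..t0})"
    "\<And>t. ?T \<inter> {- t..- t0} = uminus ` (T \<inter> {t0..t})" "\<And>s. ?T \<inter> {..<- s} = uminus ` (T \<inter> {s<..})"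
    by auto
  have Sup: "Sup (uminus ` (T \<inter> {t0<..b})) = - Inf (T \<inter> {t0<..b})" by (simp add: Inf_real_def)
  have rev: "- t0 \<in> ?T" "?F \<in> ?T \<rightarrow> nonempty_compacts" "- b \<in> ?T" "\<And>t. t \<in> ?T \<Longrightarrow> - b \<le> t"
    "right_variation ?F ?T < \<infinity>"
    using t0 F b fin by (auto simp: right_variation_reverse)
  obtain \<Gamma>' where *: "set_valued_selector ?T ?F \<Gamma>'" "bounded_variation_on ?T \<Gamma>'"
    "hausdorff_distance X0 (\<Gamma>' (- t0)) \<le> excess X0 (F t0)"
    "jordan_variation \<Gamma>' (?T \<inter> {- b..<- t0}) \<le> right_variation ?F (?T \<inter> {- b..<- t0})"
    "jordan_variation \<Gamma>' (?T \<inter> {- t0..}) \<le> right_variation ?F (?T \<inter> {- t0..})"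
    "\<forall>s0. - t0 > - b \<and> s0 = Sup (?T \<inter> {- b..<- t0}) \<and> s0 \<notin> ?T \<inter> {- b..<- t0} \<longrightarrow>
      (\<exists>L::real. ((\<lambda>t. jordan_variation \<Gamma>' (?T \<inter> {t..- t0})) \<longlongrightarrow> ereal L) (at s0 within (?T \<inter> {..<s0})))"
    "jordan_variation \<Gamma>' ?T - J_left ?T (- b) \<Gamma>' (- t0)
       \<le> right_variation ?F (?T \<inter> {- b..<- t0}) + right_variation ?F (?T \<inter> {- t0..})"
    "right_variation ?F (?T \<inter> {- b..<- t0}) + right_variation ?F (?T \<inter> {- t0..}) \<le> right_variation ?F ?T"
    "- t0 > - b \<and> Sup (?T \<inter> {- b..<- t0}) = - t0 \<longrightarrow>
      (\<exists>L::real. ((\<lambda>t. hausdorff_distance (\<Gamma>' t) (\<Gamma>' (- t0))) \<longlongrightarrow> L) (at (- t0) within (?T \<inter> {..<- t0})) \<and>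
        J_left ?T (- b) \<Gamma>' (- t0) = ereal L)"
    by (rule exE[OF right_variation_selector[OF rev(1) X0 rev(2-)]], assumption,
        unfold minus_minus, elim conjE) (rule that; assumption)
  define \<Gamma> where "\<Gamma> t = \<Gamma>' (- t)" for t
  have \<Gamma>': "\<Gamma>' = (\<lambda>t. \<Gamma> (- t))" by (simp add: \<Gamma>_def)
  note rev = jordan_variation_reverse right_variation_reverse J_left_reverse minus_minus
  show ?thesis
  proof (intro exI[of _ \<Gamma>] conjI allI impI; (elim conjE)?)
    show "set_valued_selector T F \<Gamma>" using *(1) by (auto simp: set_valued_selector_def \<Gamma>' Pi_iff)
    show "bounded_variation_on T \<Gamma>" using *(2) unfolding \<Gamma>' bounded_variation_on_def rev .
    show "hausdorff_distance X0 (\<Gamma> t0) \<le> excess X0 (F t0)" using *(3) unfolding \<Gamma>' rev .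
    show "jordan_variation \<Gamma> (T \<inter> {t0<..b}) \<le> left_variation F (T \<inter> {t0<..b})"
      using *(4) unfolding \<Gamma>' img rev .
    show "jordan_variation \<Gamma> (T \<inter> {..t0}) \<le> left_variation F (T \<inter> {..t0})"
      using *(5) unfolding \<Gamma>' img rev .
    show "jordan_variation \<Gamma> T - J_right T b \<Gamma> t0
        \<le> left_variation F (T \<inter> {t0<..b}) + left_variation F (T \<inter> {..t0})"
      using *(7) unfolding \<Gamma>' img rev .
    show "left_variation F (T \<inter> {t0<..b}) + left_variation F (T \<inter> {..t0}) \<le> left_variation F T"
      using *(8) unfolding img rev .
    show "\<exists>L::real. ((\<lambda>t. jordan_variation \<Gamma> (T \<inter> {t0..t})) \<longlongrightarrow> ereal L) (at s0 within (T \<inter> {s0<..}))"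
      if s0: "t0 < b" "s0 = Inf (T \<inter> {t0<..b})" "s0 \<notin> T \<inter> {t0<..b}" for s0
    proof -
      have "- s0 \<notin> ?T \<inter> {- b..<- t0}" using s0(3) by auto
      moreover have "- s0 = Sup (?T \<inter> {- b..<- t0})" by (simp add: img Sup s0(2))
      ultimately have "\<exists>L::real. ((\<lambda>t. jordan_variation \<Gamma>' (?T \<inter> {t..- t0})) \<longlongrightarrow> ereal L)
          (at (- s0) within (?T \<inter> {..<- s0}))"
        using *(6) s0(1) by simp
      then show ?thesis unfolding \<Gamma>' img(4) tendsto_reverse img(3) rev .
    qed
    show "\<exists>L::real. ((\<lambda>t. hausdorff_distance (\<Gamma> t0) (\<Gamma> t)) \<longlongrightarrow> L) (at t0 within (T \<inter> {t0<..})) \<and>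
        J_right T b \<Gamma> t0 = ereal L" if "t0 < b" "Inf (T \<inter> {t0<..b}) = t0"
    proof -
      have "Sup (?T \<inter> {- b..<- t0}) = - t0" by (simp add: img Sup that(2))
      then have "\<exists>L::real. ((\<lambda>t. hausdorff_distance (\<Gamma>' t) (\<Gamma>' (- t0))) \<longlongrightarrow> L)
          (at (- t0) within (?T \<inter> {..<- t0})) \<and> J_left ?T (- b) \<Gamma>' (- t0) = ereal L"
        using *(9) that(1) by simp
      then show ?thesis
        unfolding \<Gamma>' img(4) tendsto_reverse rev by (subst hausdorff_distance_commute)
    qed
  qed
qed

theorem theorem1:
  fixes T :: "real set" and t0 :: real
    and X0 :: "'a::metric_space set" and F :: "real \<Rightarrow> 'a set"
  assumes "t0 \<in> T" and "X0 \<in> nonempty_compacts" and "F \<in> T \<rightarrow> nonempty_compacts"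
  shows
    "(\<forall>a. bdd_below T \<and> a = Inf T \<and> a \<in> T \<and> right_variation F T < \<infinity> \<longrightarrow>
       (\<exists>\<Gamma>. set_valued_selector T F \<Gamma> \<and> bounded_variation_on T \<Gamma> \<and>
         hausdorff_distance X0 (\<Gamma> t0) \<le> excess X0 (F t0) \<and>
         jordan_variation \<Gamma> (T \<inter> {a..<t0}) \<le> right_variation F (T \<inter> {a..<t0}) \<and>
         jordan_variation \<Gamma> (T \<inter> {t0..}) \<le> right_variation F (T \<inter> {t0..}) \<and>
         (\<forall>s0. t0 > a \<and> s0 = Sup (T \<inter> {a..<t0}) \<and> s0 \<notin> T \<inter> {a..<t0} \<longrightarrow>
           (\<exists>L::real. ((\<lambda>t. jordan_variation \<Gamma> (T \<inter> {t..t0})) \<longlongrightarrow> ereal L)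
                        (at s0 within (T \<inter> {..<s0})))) \<and>
         jordan_variation \<Gamma> T - J_left T a \<Gamma> t0
           \<le> right_variation F (T \<inter> {a..<t0}) + right_variation F (T \<inter> {t0..}) \<and>
         right_variation F (T \<inter> {a..<t0}) + right_variation F (T \<inter> {t0..})
           \<le> right_variation F T \<and>
         (t0 > a \<and> Sup (T \<inter> {a..<t0}) = t0 \<longrightarrow>
           (\<exists>L::real. ((\<lambda>t. hausdorff_distance (\<Gamma> t) (\<Gamma> t0)) \<longlongrightarrow> L)
                        (at t0 within (T \<inter> {..<t0})) \<and>
                      J_left T a \<Gamma> t0 = ereal L)))) \<and>
     (\<forall>b. bdd_above T \<and> b = Sup T \<and> b \<in> T \<and> left_variation F T < \<infinity> \<longrightarrow>
       (\<exists>\<Gamma>. set_valued_selector T F \<Gamma> \<and> bounded_variation_on T \<Gamma> \<and>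
         hausdorff_distance X0 (\<Gamma> t0) \<le> excess X0 (F t0) \<and>
         jordan_variation \<Gamma> (T \<inter> {t0<..b}) \<le> left_variation F (T \<inter> {t0<..b}) \<and>
         jordan_variation \<Gamma> (T \<inter> {..t0}) \<le> left_variation F (T \<inter> {..t0}) \<and>
         (\<forall>s0. t0 < b \<and> s0 = Inf (T \<inter> {t0<..b}) \<and> s0 \<notin> T \<inter> {t0<..b} \<longrightarrow>
           (\<exists>L::real. ((\<lambda>t. jordan_variation \<Gamma> (T \<inter> {t0..t})) \<longlongrightarrow> ereal L)
                        (at s0 within (T \<inter> {s0<..})))) \<and>
         jordan_variation \<Gamma> T - J_right T b \<Gamma> t0
           \<le> left_variation F (T \<inter> {t0<..b}) + left_variation F (T \<inter> {..t0}) \<and>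
         left_variation F (T \<inter> {t0<..b}) + left_variation F (T \<inter> {..t0})
           \<le> left_variation F T \<and>
         (t0 < b \<and> Inf (T \<inter> {t0<..b}) = t0 \<longrightarrow>
           (\<exists>L::real. ((\<lambda>t. hausdorff_distance (\<Gamma> t0) (\<Gamma> t)) \<longlongrightarrow> L)
                        (at t0 within (T \<inter> {t0<..})) \<and>
                      J_right T b \<Gamma> t0 = ereal L))))"
proof ((intro conjI allI impI; elim conjE), goal_cases)
  case (1 a)
  then show ?case
    by (intro right_variation_selector[OF assms]) (auto intro: cInf_lower)
next
  case (2 b)
  then show ?case
    by (intro left_variation_selector[OF assms]) (auto intro: cSup_upper)
qed

end
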